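(* Let $n\ge3$, let $g_1,\ldots,g_n>0$ be pair-sum nonresonant weights, let $D_t=\operatorname{diag}(t^{g_1},\ldots,t^{g_n})$ for $t>0$, let $q>0$, and put $N=\binom n2$. Let $f:\mathbb R_{++}^n\to\mathbb R_{++}$ be a weighted-homogeneous production function, that is, $f$ is $C^2$, $f_i>0$ on $\mathbb R^n_{++}$ for all $i$, and $f(D_tx)=t^qf(x)$ for all $t>0$ and $x\in\mathbb R^n_{++}$. Suppose there exist $N$ distinct output levels $c_1,\ldots,c_N>0$ for which the isoquants $M_{c_r}=f^{-1}(c_r)$, $r=1,\ldots,N$, are Euclidean minimal. Then every isoquant $M_c=f^{-1}(c)$, $c>0$, is affine. More precisely, for any fixed reference level $c_0>0$ there are constants $A_1,\ldots,A_n>0$ such that, for every $c>0$, $$M_c=\left\{x\in\mathbb R_{++}^n:\sum_{i=1}^n A_i\left(\frac{c}{c_0}\right)^{-g_i/q}x_i=1\right\},$$ and, for every $x\in\mathbb R^n_{++}$, $$f(x)=c_0\,\rho(x)^q,$$ where $\rho(x)>0$ is the unique positive solution of $$\sum_{i=1}^nA_ix_i\,\rho(x)^{-g_i}=1.$$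
   Context: $\mathbb R_{++}=(0,\infty)$ and $\mathbb R^n_{++}=(0,\infty)^n$; $f_i=\partial f/\partial x_i$. Weights $g_1,\ldots,g_n>0$ are pair-sum nonresonant if the $\binom n2$ sums $g_i+g_j$ ($1\le i<j\le n$) are all distinct. A $C^2$ hypersurface is Euclidean minimal if its Euclidean mean-curvature vector vanishes identically. An isoquant is affine if it is contained in an affine hyperplane of $\mathbb R^n$ as a relatively open subset. *)

theory Defs
  imports "HOL-Analysis.Analysis"
begin

definition partial_deriv :: "'n::finite \<Rightarrow> (real ^ 'n \<Rightarrow> 'b::real_normed_vector) \<Rightarrow> real ^ 'n \<Rightarrow> 'b" where
  "partial_deriv i f x = vector_derivative (\<lambda>t. f (x + t *\<^sub>R axis i 1)) (at 0)"

(* Only meaningful for open S, where it is equivalent to continuous Frechet differentiability. *)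
definition C1_on :: "(real ^ 'n::finite \<Rightarrow> 'b::real_normed_vector) \<Rightarrow> (real ^ 'n) set \<Rightarrow> bool" where
  "C1_on f S \<longleftrightarrow> (\<forall>x\<in>S. f differentiable (at x)) \<and> (\<forall>i. continuous_on S (partial_deriv i f))"

definition C2_on :: "(real ^ 'n::finite \<Rightarrow> 'b::real_normed_vector) \<Rightarrow> (real ^ 'n) set \<Rightarrow> bool" where
  "C2_on f S \<longleftrightarrow> C1_on f S \<and> (\<forall>i. C1_on (partial_deriv i f) S)"

definition C2_hypersurface :: "(real ^ 'n::finite) set \<Rightarrow> bool" where
  "C2_hypersurface M \<longleftrightarrow>
     (\<forall>p\<in>M. \<exists>U F. open U \<and> p \<in> U \<and> C2_on (F :: real ^ 'n \<Rightarrow> real) U \<and>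
        (\<forall>x\<in>U. \<exists>i. partial_deriv i F x \<noteq> 0) \<and> M \<inter> U = {x \<in> U. F x = 0})"

definition tangent_space :: "(real ^ 'n::finite) set \<Rightarrow> real ^ 'n \<Rightarrow> (real ^ 'n) set" where
  "tangent_space M p =
     {v. \<exists>\<gamma> e. 0 < e \<and> \<gamma> C1_differentiable_on {-e<..<e} \<and> \<gamma> ` {-e<..<e} \<subseteq> M \<and>
           \<gamma> 0 = p \<and> (\<gamma> has_vector_derivative v) (at 0)}"

definition normal_component :: "(real ^ 'n::finite) set \<Rightarrow> real ^ 'n \<Rightarrow> real ^ 'n" where
  "normal_component T x = (THE y. (\<forall>v\<in>T. orthogonal y v) \<and> x - y \<in> T)"

(* II(v, w) is the normal part of the Euclidean derivative D_v W at p, where W is any C^1 field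
   near p that is tangent to M along M and satisfies W(p) = w; on a C^2 hypersurface such a field
   exists and the normal part does not depend on its choice. *)
definition second_fundamental_form ::
    "(real ^ 'n::finite) set \<Rightarrow> real ^ 'n \<Rightarrow> real ^ 'n \<Rightarrow> real ^ 'n \<Rightarrow> real ^ 'n" where
  "second_fundamental_form M p v w =
     (THE y. \<exists>W U. open U \<and> p \<in> U \<and> C1_on W U \<and>
        (\<forall>x\<in>M \<inter> U. W x \<in> tangent_space M x) \<and> W p = w \<and>
        y = normal_component (tangent_space M p) (frechet_derivative W (at p) v))"

definition orthonormal_basis_of :: "(real ^ 'n::finite) set \<Rightarrow> (real ^ 'n) set \<Rightarrow> bool" where
  "orthonormal_basis_of T B \<longleftrightarrow>
     B \<subseteq> T \<and> pairwise orthogonal B \<and> (\<forall>e\<in>B. norm e = 1) \<and> span B = T"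

(* Normalized trace of II; the trace does not depend on the orthonormal basis selected. *)
definition mean_curvature_vector :: "(real ^ 'n::finite) set \<Rightarrow> real ^ 'n \<Rightarrow> real ^ 'n" where
  "mean_curvature_vector M p =
     (let B = (SOME B. orthonormal_basis_of (tangent_space M p) B)
      in (1 / real (card B)) *\<^sub>R (\<Sum>e\<in>B. second_fundamental_form M p e e))"

definition euclidean_minimal :: "(real ^ 'n::finite) set \<Rightarrow> bool" where
  "euclidean_minimal M \<longleftrightarrow> C2_hypersurface M \<and> (\<forall>p\<in>M. mean_curvature_vector M p = 0)"

definition pos_orthant :: "(real ^ 'n::finite) set" where
  "pos_orthant = {x. \<forall>i. 0 < x $ i}"

definition isoquant :: "(real ^ 'n::finite \<Rightarrow> real) \<Rightarrow> real \<Rightarrow> (real ^ 'n) set" where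
  "isoquant f c = {x \<in> pos_orthant. f x = c}"

definition affine_isoquant :: "(real ^ 'n::finite) set \<Rightarrow> bool" where
  "affine_isoquant M \<longleftrightarrow> (\<exists>a b. a \<noteq> 0 \<and> openin (top_of_set {x. a \<bullet> x = b}) M)"

definition pair_sum_nonresonant :: "('n::finite \<Rightarrow> real) \<Rightarrow> bool" where
  "pair_sum_nonresonant g \<longleftrightarrow> inj_on (\<lambda>P. \<Sum>i\<in>P. g i) {P. card P = 2}"

definition weighted_dilation :: "('n::finite \<Rightarrow> real) \<Rightarrow> real \<Rightarrow> real ^ 'n \<Rightarrow> real ^ 'n" where
  "weighted_dilation g t x = (\<chi> i. t powr g i * x $ i)"

(* f is a total function here, but only its values on the positive orthant are constrained. *)
definition weighted_homogeneous_production ::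
    "('n::finite \<Rightarrow> real) \<Rightarrow> real \<Rightarrow> (real ^ 'n \<Rightarrow> real) \<Rightarrow> bool" where
  "weighted_homogeneous_production g q f \<longleftrightarrow>
     (\<forall>x\<in>pos_orthant. 0 < f x) \<and> C2_on f pos_orthant \<and>
     (\<forall>x\<in>pos_orthant. \<forall>i. 0 < partial_deriv i f x) \<and>
     (\<forall>t>0. \<forall>x\<in>pos_orthant. f (weighted_dilation g t x) = t powr q * f x)"

end

theory Submission
  imports Defs
begin

text \<open>Write \<open>f\<^sub>i\<close>, \<open>f\<^sub>i\<^sub>j\<close> for the partial derivatives. The mean curvature of an isoquant is, up to a nonzero
  factor, the sum over pairs \<open>i < j\<close> of
  \<open>\<kappa>\<^sub>i\<^sub>j = f\<^sub>i\<^sub>i f\<^sub>j\<^sup>2 - 2 f\<^sub>i f\<^sub>j f\<^sub>i\<^sub>j + f\<^sub>j\<^sub>j f\<^sub>i\<^sup>2\<close>. Homogeneity multiplies \<open>\<kappa>\<^sub>i\<^sub>j\<close> by \<open>t\<close> to the power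
  \<open>3 q - 2 (g\<^sub>i + g\<^sub>j)\<close> under \<open>D\<^sub>t\<close>, so minimality at \<open>N\<close> levels says that along every dilation
  orbit a generalised polynomial with \<open>N\<close> distinct exponents has \<open>N\<close> positive zeros. Such
  a polynomial is zero, hence every \<open>\<kappa>\<^sub>i\<^sub>j\<close> vanishes identically. By polarisation the Hessian of \<open>f\<close>
  maps tangent vectors of the isoquants to multiples of the gradient, so the gradient direction is
  constant on each isoquant, which therefore lies in a hyperplane with positive coefficients.
  Strict monotonicity along dilation orbits shows that the isoquant is the whole hyperplane section.\<close>

subsection \<open>Gradients and Hessians\<close>

definition grad :: "(real ^ 'n::finite \<Rightarrow> real) \<Rightarrow> real ^ 'n \<Rightarrow> real ^ 'n" where
  "grad f x = (\<chi> i. partial_deriv i f x)"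

text \<open>Kept vector-valued, as the derivative of the gradient in direction \<open>v\<close>, so
  that symmetry of the second partials is proved rather than built in.\<close>

definition hess :: "(real ^ 'n::finite \<Rightarrow> real) \<Rightarrow> real ^ 'n \<Rightarrow> real ^ 'n \<Rightarrow> real ^ 'n" where
  "hess f x v = (\<chi> i. grad (partial_deriv i f) x \<bullet> v)"

lemma grad_nth: "grad f x $ i = partial_deriv i f x"
  by (simp add: grad_def)

lemma partial_deriv_eq:
  assumes "(f has_derivative f') (at x)"
  shows "partial_deriv i f x = f' (axis i 1)"
proof -
  have "((\<lambda>t. f (x + t *\<^sub>R axis i 1)) has_derivative (\<lambda>t. f' (t *\<^sub>R axis i 1))) (at 0)"
    by (rule has_derivative_compose[where g = f])
       (auto intro!: derivative_eq_intros assms)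
  moreover have "f' (t *\<^sub>R axis i 1) = t *\<^sub>R f' (axis i 1)" for t
    using has_derivative_linear[OF assms] by (rule linear_cmul)
  ultimately have "((\<lambda>t. f (x + t *\<^sub>R axis i 1)) has_vector_derivative f' (axis i 1)) (at 0)"
    by (simp add: has_vector_derivative_def)
  then show ?thesis
    unfolding partial_deriv_def by (rule vector_derivative_at)
qed

lemma has_derivative_grad:
  assumes "f differentiable (at x)"
  shows "(f has_derivative (\<lambda>v. grad f x \<bullet> v)) (at x)"
proof -
  obtain f' where f': "(f has_derivative f') (at x)"
    using assms by (auto simp: differentiable_def)
  have "f' v = grad f x \<bullet> v" for v
  proof -
    have "f' v = f' (\<Sum>i\<in>UNIV. v $ i *\<^sub>R axis i 1)"
      by (simp add: basis_expansion[of v, unfolded scalar_mult_eq_scaleR])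
    also have "\<dots> = (\<Sum>i\<in>UNIV. v $ i *\<^sub>R f' (axis i 1))"
      using has_derivative_linear[OF f'] by (simp add: linear_sum linear_cmul)
    also have "\<dots> = grad f x \<bullet> v"
      by (simp add: grad_def inner_vec_def partial_deriv_eq[OF f'] mult.commute)
    finally show ?thesis .
  qed
  then have "f' = (\<lambda>v. grad f x \<bullet> v)" by auto
  with f' show ?thesis by simp
qed

lemma continuous_on_grad: "C2_on f S \<Longrightarrow> continuous_on S (grad f)"
  unfolding grad_def [abs_def] C2_on_def C1_on_def
  by (intro continuous_on_vec_lambda) auto

lemma has_derivative_hess:
  assumes "\<And>i. partial_deriv i f differentiable (at x)"
  shows "(grad f has_derivative hess f x) (at x)"
proof -
  have "(grad f has_derivative (\<lambda>v. \<chi> i. grad (partial_deriv i f) x \<bullet> v)) (at x)"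
    by (rule has_derivative_componentwise_within[THEN iffD2])
      (auto simp: Basis_vec_def inner_axis grad_nth
        intro!: has_derivative_grad assms)
  moreover have "hess f x = (\<lambda>v. \<chi> i. grad (partial_deriv i f) x \<bullet> v)"
    by (auto simp: hess_def)
  ultimately show ?thesis by simp
qed

lemma hess_inner:
  "hess f x v \<bullet> w =
     (\<Sum>i\<in>UNIV. \<Sum>j\<in>UNIV. partial_deriv j (partial_deriv i f) x * v $ j * w $ i)"
  by (simp add: hess_def grad_def inner_vec_def sum_distrib_right)

lemma hess_axis: "hess f x (axis i 1) \<bullet> axis j 1 = partial_deriv i (partial_deriv j f) x"
  by (simp add: hess_def grad_def inner_axis)

lemma linear_hess: "linear (hess f x)"
  by (rule linearI) (simp_all add: hess_def inner_right_distrib vec_eq_iff)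

lemma has_real_derivative_partial:
  assumes "f differentiable (at (a + s *\<^sub>R axis i 1))"
  shows "((\<lambda>s. f (a + s *\<^sub>R axis i 1)) has_real_derivative
           partial_deriv i f (a + s *\<^sub>R axis i 1)) (at s)"
proof -
  have "((\<lambda>s. a + s *\<^sub>R axis i 1) has_derivative (\<lambda>h. h *\<^sub>R axis i 1)) (at s)"
    by (auto intro!: derivative_eq_intros)
  from has_derivative_compose[OF this has_derivative_grad[OF assms]]
  have "((\<lambda>s. f (a + s *\<^sub>R axis i 1)) has_derivative
      (\<lambda>h. grad f (a + s *\<^sub>R axis i 1) \<bullet> (h *\<^sub>R axis i 1))) (at s)" .
  then show ?thesis
    by (simp add: has_field_derivative_def inner_axis grad_def mult_commute_abs)
qed

text \<open>The mean value theorem is used twice: in direction \<open>i\<close> on the increment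
  \<open>\<phi>\<close> of \<open>f\<close> along \<open>axis j 1\<close>, then in direction
  \<open>j\<close> on the partial derivative that this produces.\<close>

lemma second_difference:
  fixes f :: "real ^ 'n::finite \<Rightarrow> real"
  assumes C2: "C2_on f S" and ball: "ball x d \<subseteq> S" and h: "0 < h" "2 * h < d"
  shows "\<exists>y\<in>ball x d. f (x + h *\<^sub>R axis i 1 + h *\<^sub>R axis j 1) - f (x + h *\<^sub>R axis i 1)
           - f (x + h *\<^sub>R axis j 1) + f x = h\<^sup>2 * partial_deriv j (partial_deriv i f) y"
proof -
  have in_ball: "x + s *\<^sub>R axis i 1 + t *\<^sub>R axis j 1 \<in> ball x d"
    if "0 \<le> s" "s \<le> h" "0 \<le> t" "t \<le> h" for s t
  proof -
    have "norm (s *\<^sub>R axis i (1::real) + t *\<^sub>R axis j 1 :: real ^ 'n) \<le> s + t"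
      using that by (intro norm_triangle_le) (simp add: norm_axis_1)
    also have "\<dots> < d" using that h by linarith
    finally have "dist x (x + (s *\<^sub>R axis i 1 + t *\<^sub>R axis j 1)) < d"
      unfolding dist_norm by (metis add_diff_cancel_left' norm_minus_commute)
    then show ?thesis by (simp add: add.assoc)
  qed
  have diff1: "f differentiable (at y)" and diff2: "partial_deriv i f differentiable (at y)"
    if "y \<in> ball x d" for y
    using C2 ball that by (auto simp: C2_on_def C1_on_def)
  define \<phi> where "\<phi> s = f (x + h *\<^sub>R axis j 1 + s *\<^sub>R axis i 1) - f (x + s *\<^sub>R axis i 1)" for s
  have d\<phi>: "(\<phi> has_real_derivative partial_deriv i f (x + h *\<^sub>R axis j 1 + s *\<^sub>R axis i 1)
      - partial_deriv i f (x + s *\<^sub>R axis i 1)) (at s)" if "0 \<le> s" "s \<le> h" for s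
  proof -
    have "x + h *\<^sub>R axis j 1 + s *\<^sub>R axis i 1 \<in> ball x d"
      using in_ball[of s h] that h by (simp add: algebra_simps)
    moreover have "x + s *\<^sub>R axis i 1 \<in> ball x d"
      using in_ball[of s 0] that h by simp
    ultimately show ?thesis
      unfolding \<phi>_def
      by (intro DERIV_diff has_real_derivative_partial diff1) auto
  qed
  obtain \<xi> where \<xi>: "0 < \<xi>" "\<xi> < h" and
    eq1: "\<phi> h - \<phi> 0 = (h - 0) * (partial_deriv i f (x + h *\<^sub>R axis j 1 + \<xi> *\<^sub>R axis i 1)
      - partial_deriv i f (x + \<xi> *\<^sub>R axis i 1))"
    using MVT2[OF h(1) d\<phi>] by auto
  define z where "z = x + \<xi> *\<^sub>R axis i 1"
  have d\<psi>: "((\<lambda>t. partial_deriv i f (z + t *\<^sub>R axis j 1)) has_real_derivative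
      partial_deriv j (partial_deriv i f) (z + t *\<^sub>R axis j 1)) (at t)" if "0 \<le> t" "t \<le> h" for t
    using in_ball[of \<xi> t] that \<xi> by (intro has_real_derivative_partial diff2) (auto simp: z_def)
  obtain \<eta> where \<eta>: "0 < \<eta>" "\<eta> < h" and
    eq2: "partial_deriv i f (z + h *\<^sub>R axis j 1) - partial_deriv i f (z + 0 *\<^sub>R axis j 1) =
      (h - 0) * partial_deriv j (partial_deriv i f) (z + \<eta> *\<^sub>R axis j 1)"
    using MVT2[OF h(1) d\<psi>] by auto
  have "z + \<eta> *\<^sub>R axis j 1 \<in> ball x d"
    using in_ball[of \<xi> \<eta>] \<xi> \<eta> by (simp add: z_def)
  moreover have "\<phi> h - \<phi> 0 = h\<^sup>2 * partial_deriv j (partial_deriv i f) (z + \<eta> *\<^sub>R axis j 1)"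
    using eq1 eq2 by (simp add: z_def power2_eq_square algebra_simps)
  ultimately show ?thesis
    by (intro bexI[of _ "z + \<eta> *\<^sub>R axis j 1"]) (simp_all add: \<phi>_def algebra_simps)
qed

text \<open>Schwarz's theorem. The second difference is symmetric in \<open>i\<close> and
  \<open>j\<close>, so the two mixed partials agree at some points arbitrarily close to
  \<open>x\<close>, and continuity carries this to \<open>x\<close>.\<close>

lemma partial_deriv_commute:
  fixes f :: "real ^ 'n::finite \<Rightarrow> real"
  assumes C2: "C2_on f S" and S: "open S" and x: "x \<in> S"
  shows "partial_deriv i (partial_deriv j f) x = partial_deriv j (partial_deriv i f) x"
proof (rule ccontr)
  assume neq: "\<not> ?thesis"
  define F where "F = partial_deriv i (partial_deriv j f)"
  define G where "G = partial_deriv j (partial_deriv i f)"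
  \<comment> \<open>Half the gap: values within \<open>e\<close> of \<open>F x\<close> and of
    \<open>G x\<close> cannot coincide.\<close>
  define e where "e = dist (F x) (G x) / 2"
  have e: "e > 0" using neq by (simp add: e_def F_def G_def)
  have "continuous_on S F" "continuous_on S G"
    using C2 by (auto simp: C2_on_def C1_on_def F_def G_def)
  then have "isCont F x" "isCont G x"
    using S x by (auto simp: continuous_on_eq_continuous_at)
  then obtain a b where a: "a > 0" "\<And>y. dist y x < a \<Longrightarrow> dist (F y) (F x) < e"
    and b: "b > 0" "\<And>y. dist y x < b \<Longrightarrow> dist (G y) (G x) < e"
    using e unfolding continuous_at_eps_delta dist_norm by metis
  obtain r where r: "r > 0" "ball x r \<subseteq> S"
    using S x openE by blast
  define d where "d = min r (min a b)"
  have d: "d > 0" "ball x d \<subseteq> S" using a b r by (auto simp: d_def)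
  define h where "h = d / 3"
  have h: "0 < h" "2 * h < d" using d by (auto simp: h_def)
  obtain y where y: "y \<in> ball x d" and
    eqy: "f (x + h *\<^sub>R axis i 1 + h *\<^sub>R axis j 1) - f (x + h *\<^sub>R axis i 1)
           - f (x + h *\<^sub>R axis j 1) + f x = h\<^sup>2 * G y"
    using second_difference[OF C2 d(2) h, of i j] by (auto simp: G_def)
  obtain z where z: "z \<in> ball x d" and
    eqz: "f (x + h *\<^sub>R axis j 1 + h *\<^sub>R axis i 1) - f (x + h *\<^sub>R axis j 1)
           - f (x + h *\<^sub>R axis i 1) + f x = h\<^sup>2 * F z"
    using second_difference[OF C2 d(2) h, of j i] by (auto simp: F_def)
  have "h\<^sup>2 * G y = h\<^sup>2 * F z"
    using eqy eqz by (simp add: algebra_simps)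
  then have "G y = F z" using h by simp
  moreover have "dist (G y) (G x) < e" "dist (F z) (F x) < e"
    using y z a(2)[of z] b(2)[of y] by (auto simp: d_def dist_commute)
  ultimately have "dist (F x) (G x) < 2 * e"
    by (smt (verit) dist_commute dist_triangle)
  then show False by (simp add: e_def)
qed

subsection \<open>Exponential sums\<close>

text \<open>Rolle between neighbouring zeros, inserted in increasing order. The clause that
  \<open>z\<close> lies below some \<open>w\<close> in \<open>Z\<close> keeps the zero found above
  the old maximum distinct from the earlier ones. For empty \<open>Z\<close> the count
  \<open>card Z - 1\<close> truncates to 0.\<close>

lemma rolle_zeros:
  fixes F F' :: "real \<Rightarrow> real"
  assumes der: "\<And>x. (F has_real_derivative F' x) (at x)"
    and "finite Z" "\<And>z. z \<in> Z \<Longrightarrow> F z = 0"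
  shows "\<exists>Z'. finite Z' \<and> card Z' = card Z - 1 \<and> (\<forall>z\<in>Z'. F' z = 0 \<and> (\<exists>w\<in>Z. z < w))"
  using assms(2,3)
proof (induction Z rule: finite_linorder_max_induct)
  case empty
  then show ?case by auto
next
  case (insert b Z)
  show ?case
  proof (cases "Z = {}")
    case True
    then show ?thesis by (intro exI[of _ "{}"]) auto
  next
    case False
    define m where "m = Max Z"
    have m: "m \<in> Z" "\<And>z. z \<in> Z \<Longrightarrow> z \<le> m" "m < b"
      using insert False by (auto simp: m_def)
    obtain Z' where Z': "finite Z'" "card Z' = card Z - 1"
      "\<forall>z\<in>Z'. F' z = 0 \<and> (\<exists>w\<in>Z. z < w)"
      using insert by auto
    obtain y where y: "m < y" "y < b" "F b - F m = (b - m) * F' y"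
      using MVT2[OF \<open>m < b\<close> der] by auto
    have "F' y = 0" using y insert.prems m by auto
    moreover have "y \<notin> Z'" using Z' m y by fastforce
    moreover have "b \<notin> Z" using insert by auto
    moreover have "card Z > 0" using insert False by (simp add: card_gt_0_iff)
    ultimately show ?thesis
      using Z' y insert by (intro exI[of _ "insert y Z'"]) auto
  qed
qed

text \<open>Dividing by one exponential makes its term constant, and differentiating removes that
  term at the cost of one zero, so the induction hypothesis applies to the remaining
  exponents.\<close>

lemma exp_sum_eq_zero:
  fixes \<mu> K :: "'a \<Rightarrow> real"
  assumes "finite S" "inj_on \<mu> S" "finite Z" "card S \<le> card Z"
    and "\<And>s. s \<in> Z \<Longrightarrow> (\<Sum>a\<in>S. K a * exp (\<mu> a * s)) = 0"
  shows "\<forall>a\<in>S. K a = 0"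
  using assms
proof (induction S arbitrary: \<mu> K Z rule: finite_induct)
  case empty
  then show ?case by simp
next
  case (insert b S)
  define F where "F s = K b + (\<Sum>a\<in>S. K a * exp ((\<mu> a - \<mu> b) * s))" for s
  have "F s = exp (- \<mu> b * s) * (\<Sum>a\<in>insert b S. K a * exp (\<mu> a * s))" for s
  proof -
    have "exp ((\<mu> a - \<mu> b) * s) = exp (- \<mu> b * s) * exp (\<mu> a * s)" for a
      by (simp add: exp_add [symmetric] left_diff_distrib)
    moreover have "exp (- \<mu> b * s) * (K b * exp (\<mu> b * s)) = K b"
      by (simp add: exp_minus)
    ultimately show ?thesis
      using insert.hyps by (simp add: F_def distrib_left sum_distrib_left mult.left_commute)
  qed
  then have F0: "F s = 0" if "s \<in> Z" for s
    using insert.prems(4)[OF that] by simp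
  have "(F has_real_derivative (\<Sum>a\<in>S. K a * (\<mu> a - \<mu> b) * exp ((\<mu> a - \<mu> b) * s))) (at s)" for s
  proof -
    have "((\<lambda>s. K a * exp ((\<mu> a - \<mu> b) * s)) has_real_derivative
        K a * (\<mu> a - \<mu> b) * exp ((\<mu> a - \<mu> b) * s)) (at s)" for a
      by (auto intro!: derivative_eq_intros)
    from DERIV_add[OF DERIV_const[of "K b"] DERIV_sum[of S, OF this]] show ?thesis
      by (simp add: F_def [abs_def])
  qed
  from rolle_zeros[OF this insert.prems(2) F0]
  obtain Z' where Z': "finite Z'" "card Z' = card Z - 1"
    "\<forall>z\<in>Z'. (\<Sum>a\<in>S. K a * (\<mu> a - \<mu> b) * exp ((\<mu> a - \<mu> b) * z)) = 0"
    by auto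
  have "\<forall>a\<in>S. K a * (\<mu> a - \<mu> b) = 0"
  proof (rule insert.IH)
    show "inj_on (\<lambda>a. \<mu> a - \<mu> b) S"
      using insert.prems(1) by (auto simp: inj_on_def)
  qed (use Z' insert in auto)
  \<comment> \<open>Differentiation multiplied each coefficient by \<open>\<mu> a - \<mu> b\<close>;
    distinct exponents allow this factor to be cancelled.\<close>
  moreover have "\<mu> a \<noteq> \<mu> b" if "a \<in> S" for a
    using insert.prems(1) insert.hyps that by (auto simp: inj_on_def)
  ultimately have KS: "\<forall>a\<in>S. K a = 0" by auto
  \<comment> \<open>The constant lost in differentiating is recovered by evaluating \<open>F\<close>
    at one remaining zero.\<close>
  obtain s where "s \<in> Z"
    using insert.prems(3) insert.hyps by fastforce
  then have "K b = 0" using F0[of s] KS by (simp add: F_def)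
  with KS show ?case by simp
qed

lemma powr_sum_eq_zero:
  fixes \<mu> K :: "'a \<Rightarrow> real"
  assumes "finite S" "inj_on \<mu> S" "finite Z" "card S \<le> card Z"
    and pos: "\<And>t. t \<in> Z \<Longrightarrow> 0 < t"
    and "\<And>t. t \<in> Z \<Longrightarrow> (\<Sum>a\<in>S. K a * t powr \<mu> a) = 0"
  shows "\<forall>a\<in>S. K a = 0"
proof (rule exp_sum_eq_zero[OF assms(1,2)])
  have "inj_on ln Z" using pos by (auto simp: inj_on_def)
  then show "card S \<le> card (ln ` Z)" using assms by (simp add: card_image)
  show "(\<Sum>a\<in>S. K a * exp (\<mu> a * s)) = 0" if s: "s \<in> ln ` Z" for s
  proof -
    obtain t where t: "t \<in> Z" "s = ln t" using s by blast
    have "exp (\<mu> a * s) = t powr \<mu> a" for a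
      using t pos[OF t(1)] by (simp add: powr_def)
    with assms(6)[OF t(1)] show ?thesis by simp
  qed
qed (use assms in auto)

subsection \<open>Mean curvature of level sets\<close>

text \<open>After \<open>L b\<close> is expanded along the axes and the sums are exchanged, the sum
  over \<open>B\<close> is the orthonormal expansion of \<open>axis i 1\<close>. This compares the
  trace in a basis adapted to a tangent space with the sum of the pure second partials.\<close>

lemma trace_orthonormal_basis:
  fixes L :: "real ^ 'n::finite \<Rightarrow> real ^ 'n"
  assumes L: "linear L" and B: "pairwise orthogonal B" "\<And>b. b \<in> B \<Longrightarrow> norm b = 1"
    "finite B" "span B = UNIV"
  shows "(\<Sum>b\<in>B. L b \<bullet> b) = (\<Sum>i\<in>UNIV. L (axis i 1) \<bullet> axis i 1)"
proof -
  have "L b = (\<Sum>i\<in>UNIV. (axis i 1 \<bullet> b) *\<^sub>R L (axis i 1))" for b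
  proof -
    have "L b = L (\<Sum>i\<in>UNIV. b $ i *\<^sub>R axis i 1)"
      by (simp add: basis_expansion[of b, unfolded scalar_mult_eq_scaleR])
    then show ?thesis
      using L by (simp add: linear_sum linear_cmul inner_axis')
  qed
  then have "(\<Sum>b\<in>B. L b \<bullet> b) =
      (\<Sum>b\<in>B. \<Sum>i\<in>UNIV. (axis i 1 \<bullet> b) * (L (axis i 1) \<bullet> b))"
    by (metis (no_types, lifting) inner_scaleR_left inner_sum_left sum.cong)
  also have "\<dots> = (\<Sum>i\<in>UNIV. L (axis i 1) \<bullet> (\<Sum>b\<in>B. (axis i 1 \<bullet> b) *\<^sub>R b))"
    by (subst sum.swap) (simp add: inner_sum_right)
  also have "\<dots> = (\<Sum>i\<in>UNIV. L (axis i 1) \<bullet> axis i 1)"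
    using B by (subst orthonormal_basis_expand) auto
  finally show ?thesis .
qed

text \<open>Any two candidates for the definite description differ by a vector that lies in the
  hyperplane and is also orthogonal to it, hence is zero.\<close>

lemma normal_component_hyperplane:
  assumes "\<nu> \<noteq> 0"
  shows "normal_component {v. \<nu> \<bullet> v = 0} z = ((\<nu> \<bullet> z) / (\<nu> \<bullet> \<nu>)) *\<^sub>R \<nu>"
  unfolding normal_component_def
proof (rule the_equality)
  show "(\<forall>v\<in>{v. \<nu> \<bullet> v = 0}. orthogonal (((\<nu> \<bullet> z) / (\<nu> \<bullet> \<nu>)) *\<^sub>R \<nu>) v) \<and>
      z - ((\<nu> \<bullet> z) / (\<nu> \<bullet> \<nu>)) *\<^sub>R \<nu> \<in> {v. \<nu> \<bullet> v = 0}"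
    using assms by (simp add: orthogonal_def inner_diff_right)
next
  fix y
  assume y: "(\<forall>v\<in>{v. \<nu> \<bullet> v = 0}. orthogonal y v) \<and> z - y \<in> {v. \<nu> \<bullet> v = 0}"
  define y' where "y' = ((\<nu> \<bullet> z) / (\<nu> \<bullet> \<nu>)) *\<^sub>R \<nu>"
  have T: "\<nu> \<bullet> (y - y') = 0"
    using y assms by (simp add: y'_def inner_diff_right)
  then have "y \<bullet> (y - y') = 0" "y' \<bullet> (y - y') = 0"
    using y by (simp_all add: orthogonal_def y'_def)
  then have "(y - y') \<bullet> (y - y') = 0" by (simp add: inner_diff_left)
  then show "y = y'" by simp
qed

text \<open>Collects what the curvature computation uses. The tangent spaces enter as an assumption,
  so that no parametrisation of \<open>M\<close> is required here.\<close>

locale regular_level_set =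
  fixes f :: "real ^ 'n::finite \<Rightarrow> real" and S M :: "(real ^ 'n) set"
  assumes C2: "C2_on f S" and S: "open S" and MS: "M \<subseteq> S"
    and grad_nonzero: "\<And>x. x \<in> S \<Longrightarrow> grad f x \<noteq> 0"
    and tangent: "\<And>x. x \<in> M \<Longrightarrow> tangent_space M x = {v. grad f x \<bullet> v = 0}"
begin

lemma grad_derivative: "x \<in> S \<Longrightarrow> (grad f has_derivative hess f x) (at x)"
  using C2 by (intro has_derivative_hess) (auto simp: C2_on_def C1_on_def)

text \<open>Differentiate the identity \<open>grad f x \<bullet> W x = 0\<close> along a curve in
  \<open>M\<close> with velocity \<open>v\<close>. The right-hand side involves \<open>W\<close>
  only through \<open>W p\<close>, which makes the second fundamental form well defined.\<close>

lemma normal_part_of_tangent_field: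
  assumes p: "p \<in> M" and v: "v \<in> tangent_space M p"
    and W: "open U" "p \<in> U" "C1_on W U" "\<forall>x\<in>M \<inter> U. W x \<in> tangent_space M x"
  shows "grad f p \<bullet> frechet_derivative W (at p) v = - (hess f p v \<bullet> W p)"
proof -
  obtain \<gamma> e where e: "0 < e" and \<gamma>: "\<gamma> ` {-e<..<e} \<subseteq> M" "\<gamma> 0 = p"
    "(\<gamma> has_vector_derivative v) (at 0)"
    using v by (auto simp: tangent_space_def)
  have d\<gamma>: "(\<gamma> has_derivative (\<lambda>s. s *\<^sub>R v)) (at 0)"
    using \<gamma>(3) by (simp add: has_vector_derivative_def)
  let ?DW = "frechet_derivative W (at p)"
  have dW: "(W has_derivative ?DW) (at (\<gamma> 0))"
    using W \<gamma> by (auto simp: C1_on_def frechet_derivative_works)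
  have dg: "(grad f has_derivative hess f p) (at (\<gamma> 0))"
    using grad_derivative p MS \<gamma> by auto
  have "((\<lambda>s. grad f (\<gamma> s) \<bullet> W (\<gamma> s)) has_derivative
      (\<lambda>s. grad f (\<gamma> 0) \<bullet> ?DW (s *\<^sub>R v) + hess f p (s *\<^sub>R v) \<bullet> W (\<gamma> 0))) (at 0)"
    by (intro has_derivative_inner has_derivative_compose[OF d\<gamma> dW]
        has_derivative_compose[OF d\<gamma> dg])
  moreover have "((\<lambda>s. grad f (\<gamma> s) \<bullet> W (\<gamma> s)) has_derivative (\<lambda>s. 0)) (at 0)"
  proof (rule has_derivative_transform_eventually[of "\<lambda>s. 0"])
    have "continuous (at 0) \<gamma>"
      using d\<gamma> has_derivative_continuous by blast
    then have "\<forall>\<^sub>F s in at 0. \<gamma> s \<in> U"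
      using W \<gamma> by (auto simp: continuous_at intro: topological_tendstoD)
    moreover have "\<forall>\<^sub>F s in at 0. s \<in> {-e<..<e}"
      using e by (intro eventually_at_in_open') auto
    ultimately show "\<forall>\<^sub>F s in at 0. 0 = grad f (\<gamma> s) \<bullet> W (\<gamma> s)"
    proof eventually_elim
      case (elim s)
      then have "\<gamma> s \<in> M \<inter> U" using \<gamma> by auto
      then show ?case using W tangent by auto
    qed
    show "0 = grad f (\<gamma> 0) \<bullet> W (\<gamma> 0)"
      using W tangent p \<gamma> by auto
  qed auto
  ultimately have "(\<lambda>s. grad f (\<gamma> 0) \<bullet> ?DW (s *\<^sub>R v) + hess f p (s *\<^sub>R v) \<bullet> W (\<gamma> 0))
      = (\<lambda>s. 0)"
    by (rule has_derivative_unique)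
  from fun_cong[OF this, of 1] show ?thesis using \<gamma> by simp
qed

text \<open>Subtracting from the constant field \<open>w\<close> its component along the gradient
  gives the field. It is the existence witness for the description in
  \<open>second_fundamental_form\<close>.\<close>

lemma tangent_field_exists:
  obtains W where "C1_on W S" "\<And>x. x \<in> S \<Longrightarrow> grad f x \<bullet> W x = 0"
    "\<And>x. grad f x \<bullet> w = 0 \<Longrightarrow> W x = w"
proof
  define N where "N = grad f"
  define W where "W x = w - ((N x \<bullet> w) / (N x \<bullet> N x)) *\<^sub>R N x" for x
  \<comment> \<open>The derivative of \<open>W\<close> by the product and quotient rules, written
    out so that the continuity of the partial derivatives of \<open>W\<close> can be read
    off.\<close>
  define D where "D x v = - (((N x \<bullet> w) / (N x \<bullet> N x)) *\<^sub>R hess f x v +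
      ((hess f x v \<bullet> w) / (N x \<bullet> N x) -
        (N x \<bullet> w) * (2 * (N x \<bullet> hess f x v)) / (N x \<bullet> N x)\<^sup>2) *\<^sub>R N x)" for x v
  have N0: "N x \<bullet> N x \<noteq> 0" if "x \<in> S" for x
    using grad_nonzero[OF that] by (simp add: N_def)
  have dW: "(W has_derivative D x) (at x)" if x: "x \<in> S" for x
  proof -
    have dN: "(N has_derivative hess f x) (at x)"
      using grad_derivative[OF x] by (simp add: N_def)
    have d1: "((\<lambda>x. N x \<bullet> w) has_derivative (\<lambda>v. hess f x v \<bullet> w)) (at x)"
      by (rule has_derivative_inner_left[OF dN])
    have d2: "((\<lambda>x. N x \<bullet> N x) has_derivative (\<lambda>v. 2 * (N x \<bullet> hess f x v))) (at x)"
      using has_derivative_inner[OF dN dN] by (simp add: inner_commute)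
    from d1 d2 have "((\<lambda>x. (N x \<bullet> w) / (N x \<bullet> N x)) has_derivative
        (\<lambda>v. ((hess f x v \<bullet> w) * (N x \<bullet> N x) - (N x \<bullet> w) * (2 * (N x \<bullet> hess f x v))) /
          ((N x \<bullet> N x) * (N x \<bullet> N x)))) (at x)"
      using N0[OF x] by (rule has_derivative_divide')
    moreover have "((hess f x v \<bullet> w) * (N x \<bullet> N x) - (N x \<bullet> w) * (2 * (N x \<bullet> hess f x v))) /
          ((N x \<bullet> N x) * (N x \<bullet> N x)) = (hess f x v \<bullet> w) / (N x \<bullet> N x) -
          (N x \<bullet> w) * (2 * (N x \<bullet> hess f x v)) / (N x \<bullet> N x)\<^sup>2" for v
      using N0[OF x] by (simp add: power2_eq_square diff_divide_distrib)
    ultimately have "((\<lambda>x. (N x \<bullet> w) / (N x \<bullet> N x)) has_derivative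
        (\<lambda>v. (hess f x v \<bullet> w) / (N x \<bullet> N x) -
          (N x \<bullet> w) * (2 * (N x \<bullet> hess f x v)) / (N x \<bullet> N x)\<^sup>2)) (at x)"
      by simp
    from has_derivative_diff[OF has_derivative_const has_derivative_scaleR[OF this dN]]
    show ?thesis
      by (simp add: W_def [abs_def] D_def [abs_def])
  qed
  have contN: "continuous_on S N" using continuous_on_grad[OF C2] by (simp add: N_def)
  have contH: "continuous_on S (\<lambda>x. hess f x (axis i 1))" for i
    using C2 unfolding hess_def C2_on_def C1_on_def
    by (intro continuous_on_vec_lambda) (simp add: inner_axis grad_nth)
  have "continuous_on S (partial_deriv i W)" for i
  proof (rule continuous_on_eq)
    show "continuous_on S (\<lambda>x. D x (axis i 1))"
      unfolding D_def using N0 by (intro continuous_intros contN contH) auto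
  qed (simp add: partial_deriv_eq[OF dW])
  then show "C1_on W S"
    using dW by (auto simp: C1_on_def differentiable_def)
  show "grad f x \<bullet> W x = 0" if "x \<in> S" for x
    using N0[OF that] by (simp add: W_def N_def inner_diff_right)
  show "W x = w" if "grad f x \<bullet> w = 0" for x
    using that by (simp add: W_def N_def)
qed

text \<open>Every admissible field yields the same normal part, and at least one such field exists,
  so the definite description has exactly this value.\<close>

lemma second_fundamental_form_eq:
  assumes p: "p \<in> M" and v: "v \<in> tangent_space M p" and w: "w \<in> tangent_space M p"
  shows "second_fundamental_form M p v w =
    - ((hess f p v \<bullet> w) / (grad f p \<bullet> grad f p)) *\<^sub>R grad f p"
  unfolding second_fundamental_form_def
proof (rule the_equality)
  have pS: "p \<in> S" using p MS by auto
  have normal: "normal_component (tangent_space M p) (frechet_derivative W (at p) v) =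
      - ((hess f p v \<bullet> w) / (grad f p \<bullet> grad f p)) *\<^sub>R grad f p"
    if "open U" "p \<in> U" "C1_on W U" "\<forall>x\<in>M \<inter> U. W x \<in> tangent_space M x" "W p = w" for W U
    using normal_part_of_tangent_field[OF p v that(1-4)] that(5) tangent[OF p]
    by (simp add: normal_component_hyperplane[OF grad_nonzero[OF pS]])
  obtain W where W: "C1_on W S" "\<And>x. x \<in> S \<Longrightarrow> grad f x \<bullet> W x = 0"
    "\<And>x. grad f x \<bullet> w = 0 \<Longrightarrow> W x = w"
    using tangent_field_exists by blast
  have W': "\<forall>x\<in>M \<inter> S. W x \<in> tangent_space M x" "W p = w"
    using W tangent w p by auto
  show "\<exists>W U. open U \<and> p \<in> U \<and> C1_on W U \<and> (\<forall>x\<in>M \<inter> U. W x \<in> tangent_space M x) \<and> W p = w \<and>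
      - ((hess f p v \<bullet> w) / (grad f p \<bullet> grad f p)) *\<^sub>R grad f p =
        normal_component (tangent_space M p) (frechet_derivative W (at p) v)"
    using normal[OF S pS W(1) W'] S pS W(1) W' by metis
  show "y = - ((hess f p v \<bullet> w) / (grad f p \<bullet> grad f p)) *\<^sub>R grad f p"
    if "\<exists>W U. open U \<and> p \<in> U \<and> C1_on W U \<and> (\<forall>x\<in>M \<inter> U. W x \<in> tangent_space M x) \<and> W p = w \<and>
      y = normal_component (tangent_space M p) (frechet_derivative W (at p) v)" for y
    using that normal by blast
qed

text \<open>Vanishing mean curvature means that the Hessian has trace zero on the tangent space.
  Adjoining the unit normal gives the full trace, which therefore equals the Hessian's value on that
  normal.\<close>

lemma mean_curvature_zero:
  assumes p: "p \<in> M" and n: "CARD('n) \<ge> 2" and H: "mean_curvature_vector M p = 0"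
  shows "(grad f p \<bullet> grad f p) * (\<Sum>i\<in>UNIV. hess f p (axis i 1) \<bullet> axis i 1) =
    hess f p (grad f p) \<bullet> grad f p"
proof -
  define T where "T = tangent_space M p"
  define \<nu> where "\<nu> = grad f p"
  have \<nu>0: "\<nu> \<noteq> 0" using grad_nonzero p MS by (auto simp: \<nu>_def)
  have T: "T = {v. \<nu> \<bullet> v = 0}" using tangent[OF p] by (simp add: T_def \<nu>_def)
  define B where "B = (SOME B. orthonormal_basis_of T B)"
  have "subspace T" unfolding T by (rule subspace_hyperplane)
  then have "\<exists>B. orthonormal_basis_of T B"
    using orthonormal_basis_subspace[of T] unfolding orthonormal_basis_of_def by metis
  then have "orthonormal_basis_of T B" unfolding B_def by (rule someI_ex)
  then have B: "B \<subseteq> T" "pairwise orthogonal B" "\<And>e. e \<in> B \<Longrightarrow> norm e = 1" "span B = T"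
    by (auto simp: orthonormal_basis_of_def)
  have "0 \<notin> B" using B(3) by force
  then have ind: "independent B" using B(2) pairwise_orthogonal_independent by blast
  then have finB: "finite B" using independent_imp_finite by blast
  have "card B = dim T" using ind B(4) dim_eq_card_independent dim_span by metis
  then have "card B = CARD('n) - 1" using \<nu>0 by (simp add: T dim_hyperplane)
  \<comment> \<open>With an empty basis \<open>1 / real (card B)\<close> would be 0 and the
    hypothesis \<open>H\<close> would say nothing.\<close>
  then have "card B > 0" using n by simp
  moreover have "(1 / real (card B)) *\<^sub>R (\<Sum>e\<in>B. second_fundamental_form M p e e) = 0"
    using H by (simp add: mean_curvature_vector_def Let_def B_def T_def)
  ultimately have "(\<Sum>e\<in>B. second_fundamental_form M p e e) = 0" by auto
  moreover have "(\<Sum>e\<in>B. second_fundamental_form M p e e) =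
      (\<Sum>e\<in>B. - ((hess f p e \<bullet> e) / (\<nu> \<bullet> \<nu>)) *\<^sub>R \<nu>)"
    using B(1) p by (intro sum.cong refl) (auto simp: second_fundamental_form_eq T_def \<nu>_def)
  moreover have "\<dots> = - ((\<Sum>e\<in>B. hess f p e \<bullet> e) / (\<nu> \<bullet> \<nu>)) *\<^sub>R \<nu>"
    by (simp add: scaleR_sum_left[symmetric] sum_negf sum_divide_distrib)
  ultimately have trB: "(\<Sum>e\<in>B. hess f p e \<bullet> e) = 0" using \<nu>0 by simp
  \<comment> \<open>The unit normal completes \<open>B\<close> to an orthonormal basis of the whole
    space.\<close>
  define u where "u = (1 / norm \<nu>) *\<^sub>R \<nu>"
  have u: "norm u = 1" using \<nu>0 by (simp add: u_def)
  have uB: "orthogonal u e" if "e \<in> B" for e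
    using B(1) T that by (auto simp: u_def orthogonal_def)
  have "u \<notin> B" using uB u by (force simp: orthogonal_self)
  have "x \<in> span (insert u B)" for x
  proof -
    have "x - (u \<bullet> x) *\<^sub>R u \<in> T"
      using \<nu>0 by (simp add: T u_def inner_diff_right power2_norm_eq_inner[symmetric] power2_eq_square)
    then have "x - (u \<bullet> x) *\<^sub>R u \<in> span (insert u B)"
      using B(4) span_mono[of B "insert u B"] by auto
    moreover have "(u \<bullet> x) *\<^sub>R u \<in> span (insert u B)"
      by (simp add: span_base span_mul)
    ultimately have "x - (u \<bullet> x) *\<^sub>R u + (u \<bullet> x) *\<^sub>R u \<in> span (insert u B)"
      by (rule span_add)
    then show ?thesis by simp
  qed
  then have "(\<Sum>e\<in>insert u B. hess f p e \<bullet> e) = (\<Sum>i\<in>UNIV. hess f p (axis i 1) \<bullet> axis i 1)"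
    using B u uB finB
    by (intro trace_orthonormal_basis linear_hess)
      (auto simp: pairwise_insert orthogonal_commute)
  then have "hess f p u \<bullet> u = (\<Sum>i\<in>UNIV. hess f p (axis i 1) \<bullet> axis i 1)"
    using trB finB \<open>u \<notin> B\<close> by simp
  moreover have "(\<nu> \<bullet> \<nu>) * (hess f p u \<bullet> u) = hess f p \<nu> \<bullet> \<nu>"
    using \<nu>0 by (simp add: u_def linear_cmul[OF linear_hess] power2_norm_eq_inner[symmetric] power2_eq_square)
  ultimately show ?thesis by (simp add: \<nu>_def)
qed

end

subsection \<open>Weighted-homogeneous production functions\<close>

lemma open_pos_orthant: "open (pos_orthant :: (real ^ 'n::finite) set)"
proof -
  have "open (\<Inter>i. {x :: real ^ 'n. 0 < x $ i})"
    by (intro open_INT finite ballI open_Collect_less continuous_intros)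
  also have "(\<Inter>i. {x :: real ^ 'n. 0 < x $ i}) = pos_orthant"
    by (auto simp: pos_orthant_def)
  finally show ?thesis .
qed

lemma convex_pos_orthant: "convex (pos_orthant :: (real ^ 'n::finite) set)"
  by (rule convexI)
    (auto simp: pos_orthant_def intro: add_pos_pos mult_pos_pos dest!: less_eq_real_def[THEN iffD1])

lemma one_in_pos_orthant: "(\<chi> i. 1) \<in> pos_orthant"
  by (simp add: pos_orthant_def)

lemma weighted_dilation_in_pos_orthant:
  "x \<in> pos_orthant \<Longrightarrow> 0 < t \<Longrightarrow> weighted_dilation g t x \<in> pos_orthant"
  by (simp add: pos_orthant_def weighted_dilation_def)

lemma has_derivative_weighted_dilation:
  "(weighted_dilation g t has_derivative weighted_dilation g t) (at x)"
proof -
  have "linear (weighted_dilation g t)"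
    by (rule linearI) (simp_all add: weighted_dilation_def vec_eq_iff distrib_left)
  then show ?thesis
    by (simp add: linear_conv_bounded_linear bounded_linear_imp_has_derivative)
qed

text \<open>Differentiate the homogeneity relation by the chain rule. The function \<open>h\<close>
  and the degree \<open>r\<close> are arbitrary so that the lemma also applies to first
  partials.\<close>

lemma partial_deriv_homogeneous:
  assumes diff: "\<And>x. x \<in> pos_orthant \<Longrightarrow> h differentiable (at x)"
    and hom: "\<And>t x. 0 < t \<Longrightarrow> x \<in> pos_orthant \<Longrightarrow> h (weighted_dilation g t x) = t powr r * h x"
    and t: "0 < t" and x: "x \<in> pos_orthant"
  shows "partial_deriv i h (weighted_dilation g t x) = t powr (r - g i) * partial_deriv i h x"
proof -
  let ?D = "weighted_dilation g t"
  have "((\<lambda>x. h (?D x)) has_derivative (\<lambda>v. grad h (?D x) \<bullet> ?D v)) (at x)"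
    by (intro has_derivative_compose[OF has_derivative_weighted_dilation] has_derivative_grad
        diff weighted_dilation_in_pos_orthant t x)
  moreover have "((\<lambda>x. h (?D x)) has_derivative (\<lambda>v. t powr r * (grad h x \<bullet> v))) (at x)"
    by (rule has_derivative_transform_within_open[OF _ open_pos_orthant x, of "\<lambda>x. t powr r * h x"])
      (auto intro!: has_derivative_mult_right has_derivative_grad diff x simp: hom t)
  ultimately have "(\<lambda>v. grad h (?D x) \<bullet> ?D v) = (\<lambda>v. t powr r * (grad h x \<bullet> v))"
    by (rule has_derivative_unique)
  from fun_cong[OF this, of "axis i 1"]
  have "grad h (?D x) \<bullet> ?D (axis i 1) = t powr r * partial_deriv i h x"
    by (simp add: inner_axis grad_nth)
  moreover have "?D (axis i 1) = t powr g i *\<^sub>R axis i 1"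
    by (auto simp: weighted_dilation_def vec_eq_iff axis_def)
  ultimately have "t powr g i * partial_deriv i h (?D x) = t powr r * partial_deriv i h x"
    by (simp add: inner_axis grad_nth)
  then show ?thesis
    using t by (simp add: powr_diff field_simps)
qed

text \<open>An ordered pair of distinct indices lies in exactly one two-element set, while the
  diagonal terms, repeated on the left, are zero by assumption.\<close>

lemma sum_pairs:
  fixes k :: "'n::finite \<Rightarrow> 'n \<Rightarrow> real"
  assumes "\<And>i. k i i = 0"
  shows "(\<Sum>P | card P = 2. \<Sum>i\<in>P. \<Sum>j\<in>P. k i j) = (\<Sum>i\<in>UNIV. \<Sum>j\<in>UNIV. k i j)"
proof -
  have "(\<Sum>P | card P = 2. \<Sum>i\<in>P. \<Sum>j\<in>P. k i j) =
      (\<Sum>P | card P = 2. \<Sum>i\<in>UNIV. \<Sum>j\<in>UNIV. if i \<in> P \<and> j \<in> P then k i j else 0)"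
  proof (rule sum.cong [OF refl])
    fix P :: "'n set"
    have "(\<Sum>i\<in>P. \<Sum>j\<in>P. k i j) = (\<Sum>i\<in>UNIV. if i \<in> P then \<Sum>j\<in>P. k i j else 0)"
      by (simp add: sum.If_cases)
    also have "\<dots> = (\<Sum>i\<in>UNIV. \<Sum>j\<in>UNIV. if i \<in> P \<and> j \<in> P then k i j else 0)"
      by (intro sum.cong refl) (simp add: sum.If_cases)
    finally show "(\<Sum>i\<in>P. \<Sum>j\<in>P. k i j) =
      (\<Sum>i\<in>UNIV. \<Sum>j\<in>UNIV. if i \<in> P \<and> j \<in> P then k i j else 0)" .
  qed
  also have "\<dots> = (\<Sum>i\<in>UNIV. \<Sum>j\<in>UNIV. \<Sum>P | card P = 2. if i \<in> P \<and> j \<in> P then k i j else 0)"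
    by (subst sum.swap, intro sum.cong refl, subst sum.swap) simp
  also have "\<dots> = (\<Sum>i\<in>UNIV. \<Sum>j\<in>UNIV. k i j)"
  proof (intro sum.cong refl)
    fix i j :: 'n
    show "(\<Sum>P | card P = 2. if i \<in> P \<and> j \<in> P then k i j else 0) = k i j"
    proof (cases "i = j")
      case True
      then show ?thesis using assms[of j] by (auto intro!: sum.neutral)
    next
      case False
      then have "{P. card P = 2} \<inter> {P. i \<in> P \<and> j \<in> P} = {{i, j}}"
        by (auto simp: card_2_iff)
      then show ?thesis by (simp add: sum.If_cases)
    qed
  qed
  finally show ?thesis .
qed

lemma powr_sum_strict_decreasing:
  fixes A g :: "'n::finite \<Rightarrow> real" and x :: "real ^ 'n"
  assumes "\<And>i. 0 < g i" "\<And>i. 0 < A i" "x \<in> pos_orthant" "0 < s" "s < t"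
  shows "(\<Sum>i\<in>UNIV. A i * x $ i * t powr (- g i)) < (\<Sum>i\<in>UNIV. A i * x $ i * s powr (- g i))"
proof (rule sum_strict_mono)
  fix i :: 'n
  have "t powr (- g i) < s powr (- g i)"
    using assms by (intro powr_less_mono2_neg) auto
  then show "A i * x $ i * t powr (- g i) < A i * x $ i * s powr (- g i)"
    using assms by (simp add: pos_orthant_def)
qed auto

lemma powr_sum_inj:
  fixes A g :: "'n::finite \<Rightarrow> real" and x :: "real ^ 'n"
  assumes "\<And>i. 0 < g i" "\<And>i. 0 < A i" "x \<in> pos_orthant" "0 < s" "0 < t"
    and "(\<Sum>i\<in>UNIV. A i * x $ i * s powr (- g i)) = (\<Sum>i\<in>UNIV. A i * x $ i * t powr (- g i))"
  shows "s = t"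
  using powr_sum_strict_decreasing[of g A x s t] powr_sum_strict_decreasing[of g A x t s] assms
  by (cases s t rule: linorder_cases) auto

section \<open>Production functions, the retraction onto isoquants and tangent spaces\<close>

locale production =
  fixes g :: "'n::finite \<Rightarrow> real" and q :: real and f :: "real ^ 'n \<Rightarrow> real"
  assumes g_pos: "\<And>i. 0 < g i" and q_pos: "0 < q"
    and production: "weighted_homogeneous_production g q f"
begin

lemma f_pos: "x \<in> pos_orthant \<Longrightarrow> 0 < f x"
  and C2: "C2_on f pos_orthant"
  and partial_pos: "x \<in> pos_orthant \<Longrightarrow> 0 < partial_deriv i f x"
  and f_dilation: "0 < t \<Longrightarrow> x \<in> pos_orthant \<Longrightarrow> f (weighted_dilation g t x) = t powr q * f x"
  using production by (auto simp: weighted_homogeneous_production_def)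

lemma f_differentiable: "x \<in> pos_orthant \<Longrightarrow> f differentiable (at x)"
  and partial_differentiable: "x \<in> pos_orthant \<Longrightarrow> partial_deriv i f differentiable (at x)"
  using C2 by (auto simp: C2_on_def C1_on_def)

lemma f_has_derivative: "x \<in> pos_orthant \<Longrightarrow> (f has_derivative (\<lambda>v. grad f x \<bullet> v)) (at x)"
  by (intro has_derivative_grad f_differentiable)

text \<open>Along dilation orbits the orthant retracts onto every isoquant. The retraction is as smooth
  as \<open>f\<close>, so it replaces the implicit function theorem (for curves in the isoquant) and reduces
  connectedness of the isoquant to convexity of the orthant.\<close>

definition proj :: "real \<Rightarrow> real ^ 'n \<Rightarrow> real ^ 'n" where
  "proj c x = weighted_dilation g ((c / f x) powr (1 / q)) x"

lemma proj_in_isoquant: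
  assumes "0 < c" "x \<in> pos_orthant"
  shows "proj c x \<in> isoquant f c"
  using assms f_pos[OF assms(2)] q_pos
  by (simp add: proj_def isoquant_def weighted_dilation_in_pos_orthant f_dilation powr_powr)

lemma proj_isoquant: "0 < c \<Longrightarrow> x \<in> isoquant f c \<Longrightarrow> proj c x = x"
  by (auto simp: proj_def isoquant_def weighted_dilation_def vec_eq_iff)

lemma proj_nth: "proj c x $ i = (c / f x) powr (g i / q) * x $ i"
  by (simp add: proj_def weighted_dilation_def powr_powr)

text \<open>The derivative of \<open>proj c\<close> at \<open>x\<close>, obtained from
  \<open>proj_nth\<close> by the product and chain rules; the second term comes from the variation
  of the factor \<open>(c / f x) powr (g i / q)\<close>.\<close>

definition dproj :: "real \<Rightarrow> real ^ 'n \<Rightarrow> real ^ 'n \<Rightarrow> real ^ 'n" where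
  "dproj c x v = (\<chi> i. (c / f x) powr (g i / q) * v $ i -
     (g i / q) * (c / f x) powr (g i / q) / f x * (grad f x \<bullet> v) * x $ i)"

lemma has_derivative_proj:
  assumes c: "0 < c" and x: "x \<in> pos_orthant"
  shows "(proj c has_derivative dproj c x) (at x)"
proof -
  note fx = f_pos[OF x]
  have "((\<lambda>x. proj c x $ i) has_derivative (\<lambda>v. dproj c x v $ i)) (at x)" for i
  proof -
    have "((\<lambda>y. (c / y) powr (g i / q)) has_real_derivative
        - ((g i / q) * (c / f x) powr (g i / q) / f x)) (at (f x))"
      using c fx
      by (auto intro!: derivative_eq_intros simp: powr_diff field_simps power2_eq_square)
    from has_derivative_mult[OF DERIV_compose_FDERIV[OF this f_has_derivative[OF x]]
        bounded_linear_imp_has_derivative[OF bounded_linear_vec_nth[of i]]]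
    show ?thesis by (simp add: proj_nth dproj_def algebra_simps)
  qed
  then show ?thesis
    by (subst has_derivative_componentwise_within) (auto simp: Basis_vec_def inner_axis)
qed

lemma grad_nonzero: "x \<in> pos_orthant \<Longrightarrow> grad f x \<noteq> 0"
  using partial_pos[of x] by (metis grad_nth order_less_irrefl zero_index)

lemma continuous_on_f: "continuous_on pos_orthant f"
  by (meson continuous_at_imp_continuous_on differentiable_imp_continuous_within f_differentiable)

text \<open>One inclusion holds because \<open>f\<close> is constant along curves in the isoquant.
  For the other, a straight line through \<open>p\<close> in direction \<open>v\<close> is pushed
  onto the isoquant by \<open>proj c\<close>.\<close>

lemma tangent_space_isoquant:
  assumes c: "0 < c" and p: "p \<in> isoquant f c"
  shows "tangent_space (isoquant f c) p = {v. grad f p \<bullet> v = 0}"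
proof (intro equalityI subsetI)
  fix v assume "v \<in> tangent_space (isoquant f c) p"
  then obtain \<gamma> e where e: "0 < e" and \<gamma>: "\<gamma> ` {-e<..<e} \<subseteq> isoquant f c" "\<gamma> 0 = p"
    "(\<gamma> has_vector_derivative v) (at 0)"
    by (auto simp: tangent_space_def)
  have "(f has_derivative (\<lambda>v. grad f p \<bullet> v)) (at (\<gamma> 0))"
    using p f_has_derivative \<gamma> by (auto simp: isoquant_def)
  from has_derivative_compose[OF \<gamma>(3)[unfolded has_vector_derivative_def] this]
  have "((\<lambda>s. f (\<gamma> s)) has_derivative (\<lambda>s. grad f p \<bullet> (s *\<^sub>R v))) (at 0)" .
  moreover have "((\<lambda>s. f (\<gamma> s)) has_derivative (\<lambda>s. 0)) (at 0)"
    by (rule has_derivative_transform_within_open[of "\<lambda>s. c" _ _ _ "{-e<..<e}"])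
      (use e \<gamma> in \<open>auto simp: isoquant_def image_subset_iff\<close>)
  ultimately have "(\<lambda>s. grad f p \<bullet> (s *\<^sub>R v)) = (\<lambda>s. 0)"
    by (rule has_derivative_unique)
  from fun_cong[OF this, of 1] show "v \<in> {v. grad f p \<bullet> v = 0}" by simp
next
  fix v assume v: "v \<in> {v. grad f p \<bullet> v = 0}"
  define l where "l s = p + s *\<^sub>R v" for s
  have "open (l -` pos_orthant)"
    unfolding l_def by (intro open_vimage open_pos_orthant continuous_intros)
  moreover have "0 \<in> l -` pos_orthant"
    using p by (simp add: l_def isoquant_def)
  ultimately obtain e where e: "0 < e" "ball 0 e \<subseteq> l -` pos_orthant"
    using openE by blast
  have l: "l s \<in> pos_orthant" if "s \<in> {-e<..<e}" for s
    using e(2) that by (auto simp: subset_iff)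
  define \<gamma> where "\<gamma> s = proj c (l s)" for s
  have d\<gamma>: "(\<gamma> has_vector_derivative dproj c (l s) v) (at s)" if s: "s \<in> {-e<..<e}" for s
  proof -
    have "(l has_derivative (\<lambda>h. h *\<^sub>R v)) (at s)"
      unfolding l_def by (auto intro!: derivative_eq_intros)
    from has_derivative_compose[OF this has_derivative_proj[OF c l[OF s]]]
    have "(\<gamma> has_derivative (\<lambda>h. dproj c (l s) (h *\<^sub>R v))) (at s)"
      by (simp add: \<gamma>_def [abs_def])
    moreover have "dproj c (l s) (h *\<^sub>R v) = h *\<^sub>R dproj c (l s) v" for h
      by (simp add: dproj_def vec_eq_iff algebra_simps)
    ultimately show ?thesis by (simp add: has_vector_derivative_def)
  qed
  have contl: "continuous_on {-e<..<e} l" by (auto simp: l_def intro!: continuous_intros)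
  have img: "l ` {-e<..<e} \<subseteq> pos_orthant" using l by auto
  have "continuous_on {-e<..<e} (\<lambda>s. dproj c (l s) v)"
  proof -
    have "f (l s) \<noteq> 0" if "s \<in> {-e<..<e}" for s
      using f_pos[OF l[OF that]] by simp
    then show ?thesis
      unfolding dproj_def using c
      by (intro continuous_on_vec_lambda continuous_intros contl
          continuous_on_compose2[OF continuous_on_f contl img]
          continuous_on_compose2[OF continuous_on_grad[OF C2] contl img]) auto
  qed
  then have "\<gamma> C1_differentiable_on {-e<..<e}"
    unfolding C1_differentiable_on_def using d\<gamma> by (intro exI[of _ "\<lambda>s. dproj c (l s) v"]) simp
  moreover have "\<gamma> ` {-e<..<e} \<subseteq> isoquant f c"
    using l c by (auto simp: \<gamma>_def proj_in_isoquant)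
  moreover have "\<gamma> 0 = p" using proj_isoquant[OF c p] by (simp add: \<gamma>_def l_def)
  \<comment> \<open>At \<open>p\<close> the ratio \<open>c / f p\<close> is 1, and the correction
    term has the factor \<open>grad f p \<bullet> v = 0\<close>.\<close>
  moreover have "dproj c (l 0) v = v"
    using p c v by (simp add: l_def dproj_def isoquant_def)
  ultimately show "v \<in> tangent_space (isoquant f c) p"
    using e d\<gamma>[of 0] by (auto simp: tangent_space_def)
qed

lemma isoquant_subset: "isoquant f c \<subseteq> pos_orthant"
  by (auto simp: isoquant_def)

lemma regular_level_set: "0 < c \<Longrightarrow> regular_level_set f pos_orthant (isoquant f c)"
  by unfold_locales
    (simp_all add: C2 open_pos_orthant grad_nonzero tangent_space_isoquant isoquant_subset)

text \<open>The pair term \<open>\<kappa>\<^sub>i\<^sub>j\<close> is \<open>pair_curv i j + pair_curv j i\<close>. Summed over all ordered pairs, the diagonal contributing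
  zero, this gives \<open>\<bar>\<nabla>f\<bar>\<^sup>2 \<Delta>f - D\<^sup>2f(\<nabla>f, \<nabla>f)\<close>.\<close>

definition pair_curv :: "'n \<Rightarrow> 'n \<Rightarrow> real ^ 'n \<Rightarrow> real" where
  "pair_curv i j x = partial_deriv i (partial_deriv i f) x * (partial_deriv j f x)\<^sup>2 -
     partial_deriv i f x * partial_deriv j f x * partial_deriv j (partial_deriv i f) x"

text \<open>Each derivative in direction \<open>i\<close> lowers the degree by \<open>g i\<close>.
  Both products contain three factors of \<open>f\<close> and two derivatives in each of the
  directions \<open>i\<close> and \<open>j\<close>, hence share one exponent.\<close>

lemma pair_curv_dilation:
  assumes t: "0 < t" and x: "x \<in> pos_orthant"
  shows "pair_curv i j (weighted_dilation g t x) = t powr (3 * q - 2 * (g i + g j)) * pair_curv i j x"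
proof -
  have first: "partial_deriv i f (weighted_dilation g t x) = t powr (q - g i) * partial_deriv i f x"
    if "0 < t" "x \<in> pos_orthant" for i t x
    by (rule partial_deriv_homogeneous[OF f_differentiable f_dilation that])
  have second: "partial_deriv j (partial_deriv i f) (weighted_dilation g t x) =
      t powr (q - g i - g j) * partial_deriv j (partial_deriv i f) x" for i j
    by (rule partial_deriv_homogeneous[OF partial_differentiable first t x])
  have 1: "t powr (q - g i - g i) * (t powr (q - g j))\<^sup>2 = t powr (3 * q - 2 * (g i + g j))"
    using t by (simp add: power2_eq_square powr_add [symmetric] algebra_simps)
  have 2: "t powr (q - g i) * t powr (q - g j) * t powr (q - g i - g j) =
      t powr (3 * q - 2 * (g i + g j))"
    using t by (simp add: powr_add [symmetric] algebra_simps)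
  have "(T1 * a) * (T2 * b)\<^sup>2 = T1 * T2\<^sup>2 * (a * b\<^sup>2)" for T1 T2 a b :: real
    by (simp add: power_mult_distrib mult_ac)
  moreover have "(T1 * a) * (T2 * b) * (T3 * d) = T1 * T2 * T3 * (a * b * d)"
    for T1 T2 T3 a b d :: real
    by (simp add: mult_ac)
  ultimately show ?thesis
    by (simp only: pair_curv_def first[OF t x] second 1 2 right_diff_distrib)
qed

lemma sum_pair_curv_minimal:
  assumes n: "CARD('n) \<ge> 2" and c: "0 < c" and min: "euclidean_minimal (isoquant f c)"
    and x: "x \<in> isoquant f c"
  shows "(\<Sum>i\<in>UNIV. \<Sum>j\<in>UNIV. pair_curv i j x) = 0"
proof -
  interpret regular_level_set f pos_orthant "isoquant f c"
    by (rule regular_level_set[OF c])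
  have "(grad f x \<bullet> grad f x) * (\<Sum>i\<in>UNIV. hess f x (axis i 1) \<bullet> axis i 1) =
    hess f x (grad f x) \<bullet> grad f x"
    using min x by (intro mean_curvature_zero n) (auto simp: euclidean_minimal_def)
  moreover have "(grad f x \<bullet> grad f x) * (\<Sum>i\<in>UNIV. hess f x (axis i 1) \<bullet> axis i 1) =
    (\<Sum>i\<in>UNIV. \<Sum>j\<in>UNIV. partial_deriv i (partial_deriv i f) x * (partial_deriv j f x)\<^sup>2)"
    unfolding hess_axis unfolding inner_vec_def grad_nth sum_product
    by (subst sum.swap) (simp add: power2_eq_square mult_ac)
  moreover have "hess f x (grad f x) \<bullet> grad f x = (\<Sum>i\<in>UNIV. \<Sum>j\<in>UNIV.
      partial_deriv i f x * partial_deriv j f x * partial_deriv j (partial_deriv i f) x)"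
    unfolding hess_inner grad_nth by (simp add: mult_ac)
  ultimately show ?thesis
    by (simp add: pair_curv_def sum_subtractf)
qed

lemma pair_curv_zero:
  assumes n: "CARD('n) \<ge> 2" and nonres: "pair_sum_nonresonant g"
    and C: "finite C" "CARD('n) choose 2 \<le> card C" "\<And>c. c \<in> C \<Longrightarrow> 0 < c"
      "\<And>c. c \<in> C \<Longrightarrow> euclidean_minimal (isoquant f c)"
    and x: "x \<in> pos_orthant" and ij: "i \<noteq> j"
  shows "pair_curv i j x + pair_curv j i x = 0"
proof -
  \<comment> \<open>For \<open>P = {i, j}\<close> with \<open>i \<noteq> j\<close> this is
    \<open>pair_curv i j x + pair_curv j i x\<close>, since the diagonal terms vanish.\<close>
  define K where "K P = (\<Sum>i\<in>P. \<Sum>j\<in>P. pair_curv i j x)" for P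
  define \<mu> where "\<mu> P = 3 * q - 2 * (\<Sum>i\<in>P. g i)" for P
  \<comment> \<open>The parameters at which the dilation orbit of \<open>x\<close> meets the given
    minimal levels.\<close>
  define Z where "Z = (\<lambda>c. (c / f x) powr (1 / q)) ` C"
  note fx = f_pos[OF x]
  have kii: "pair_curv i i y = 0" for i y by (simp add: pair_curv_def power2_eq_square)
  have inv: "f x * ((c / f x) powr (1 / q)) powr q = c" if "c \<in> C" for c
    using C(3)[OF that] fx q_pos by (simp add: powr_powr)
  have "inj_on (\<lambda>c. (c / f x) powr (1 / q)) C"
    by (rule inj_on_inverseI[where g = "\<lambda>t. f x * t powr q"]) (simp add: inv)
  then have Z: "finite Z" "card Z = card C" using C(1) by (auto simp: Z_def card_image)
  have "\<forall>P\<in>{P :: 'n set. card P = 2}. K P = 0"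
  proof (rule powr_sum_eq_zero[of _ \<mu> Z])
    show "inj_on \<mu> {P. card P = 2}"
      using nonres by (auto simp: pair_sum_nonresonant_def inj_on_def \<mu>_def)
    have "card {P :: 'n set. card P = 2} = CARD('n) choose 2"
      using n_subsets[of "UNIV :: 'n set" 2] by simp
    then show "card {P :: 'n set. card P = 2} \<le> card Z" using C(2) Z by simp
    show "0 < t" if "t \<in> Z" for t
      using that C(3) fx by (force simp: Z_def)
    show "(\<Sum>P | card P = 2. K P * t powr \<mu> P) = 0" if t: "t \<in> Z" for t
    proof -
      obtain c where c: "c \<in> C" and t_eq: "t = (c / f x) powr (1 / q)"
        using t by (auto simp: Z_def)
      have tpos: "0 < t" using C(3)[OF c] fx by (simp add: t_eq)
      have "weighted_dilation g t x \<in> isoquant f c"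
        using proj_in_isoquant[OF C(3)[OF c] x] by (simp add: proj_def t_eq)
      then have "(\<Sum>i\<in>UNIV. \<Sum>j\<in>UNIV. pair_curv i j (weighted_dilation g t x)) = 0"
        by (rule sum_pair_curv_minimal[OF n C(3)[OF c] C(4)[OF c]])
      then have "(\<Sum>P | card P = 2. \<Sum>i\<in>P. \<Sum>j\<in>P. pair_curv i j (weighted_dilation g t x)) = 0"
        by (simp add: sum_pairs kii)
      moreover have "(\<Sum>i\<in>P. \<Sum>j\<in>P. pair_curv i j (weighted_dilation g t x)) = K P * t powr \<mu> P"
        if P: "card P = 2" for P
      proof -
        have "pair_curv i j (weighted_dilation g t x) = pair_curv i j x * t powr \<mu> P" if "i \<in> P" "j \<in> P" for i j
        proof (cases "i = j")
          case False
          then have "P = {i, j}" using that P by (auto simp: card_2_iff)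
          then have "\<mu> P = 3 * q - 2 * (g i + g j)" using False by (simp add: \<mu>_def)
          then show ?thesis using pair_curv_dilation[OF tpos x] by simp
        qed (simp add: kii)
        then show ?thesis by (simp add: K_def sum_distrib_right)
      qed
      ultimately show ?thesis by simp
    qed
  qed (use Z in auto)
  then have "K {i, j} = 0" using ij by simp
  then show ?thesis using ij by (simp add: K_def kii)
qed

section \<open>From vanishing pair terms to hyperplane sections\<close>

text \<open>The flatness equations make the Hessian the symmetrised product of the gradient with the
  covector of entries \<open>m j * d j\<close>. On a vector orthogonal to the gradient one of the
  two terms drops out, leaving a multiple of the gradient.\<close>

lemma hess_tangent:
  assumes flat: "\<And>i j. i \<noteq> j \<Longrightarrow> pair_curv i j x + pair_curv j i x = 0"
    and x: "x \<in> pos_orthant" and v: "grad f x \<bullet> v = 0"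
  shows "\<exists>l. hess f x v = l *\<^sub>R grad f x"
proof -
  define d where "d i = partial_deriv i f x" for i
  define H where "H i j = partial_deriv j (partial_deriv i f) x" for i j
  \<comment> \<open>the diagonal case of \<open>H i j = d i * d j * (m i + m j)\<close>\<close>
  define m where "m i = H i i / (2 * (d i)\<^sup>2)" for i
  have d: "d i > 0" for i using partial_pos[OF x] by (simp add: d_def)
  have sym: "H i j = H j i" for i j
    unfolding H_def by (rule partial_deriv_commute[OF C2 open_pos_orthant x])
  have "H i j = d i * d j * (m i + m j)" for i j
  proof (cases "i = j")
    case True
    then show ?thesis using d[of i] by (simp add: m_def field_simps power2_eq_square)
  next
    case False
    \<comment> \<open>Symmetry merges the two mixed terms of the flatness equation, which can then
      be solved for \<open>H i j\<close>.\<close>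
    have "H i i * (d j)\<^sup>2 + H j j * (d i)\<^sup>2 = 2 * d i * d j * H i j"
      using flat[OF False] sym[of i j] unfolding pair_curv_def d_def[symmetric] H_def[symmetric]
      by (simp add: algebra_simps)
    then show ?thesis
      using d[of i] d[of j] by (simp add: m_def field_simps power2_eq_square)
  qed
  then have "hess f x v $ i = (\<Sum>j\<in>UNIV. m j * d j * v $ j) * grad f x $ i" for i
  proof -
    have "hess f x v $ i = (\<Sum>j\<in>UNIV. H i j * v $ j)"
      by (simp add: hess_def inner_vec_def grad_nth H_def)
    also have "\<dots> = (\<Sum>j\<in>UNIV. d i * m i * (d j * v $ j) + m j * d j * v $ j * d i)"
      using \<open>\<And>i j. H i j = d i * d j * (m i + m j)\<close> by (simp add: algebra_simps)
    also have "\<dots> = d i * m i * (grad f x \<bullet> v) + (\<Sum>j\<in>UNIV. m j * d j * v $ j) * d i"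
      by (simp add: sum.distrib sum_distrib_left sum_distrib_right inner_vec_def grad_nth d_def)
    finally show ?thesis using v by (simp add: d_def grad_nth)
  qed
  then show ?thesis
    by (intro exI[of _ "\<Sum>j\<in>UNIV. m j * d j * v $ j"]) (simp add: vec_eq_iff)
qed

text \<open>The composition of \<open>f\<close> with \<open>proj c\<close> is constant on the
  orthant, so its derivative vanishes: \<open>dproj\<close> has tangent values.\<close>

lemma grad_dproj:
  assumes c: "0 < c" and x: "x \<in> pos_orthant"
  shows "grad f (proj c x) \<bullet> dproj c x v = 0"
proof -
  have "proj c x \<in> pos_orthant" using proj_in_isoquant[OF c x] isoquant_subset by auto
  from has_derivative_compose[OF has_derivative_proj[OF c x] f_has_derivative[OF this]]
  have "((\<lambda>x. f (proj c x)) has_derivative (\<lambda>v. grad f (proj c x) \<bullet> dproj c x v)) (at x)" .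
  moreover have "((\<lambda>x. f (proj c x)) has_derivative (\<lambda>v. 0)) (at x)"
    by (rule has_derivative_transform_within_open[OF _ open_pos_orthant x, of "\<lambda>x. c"])
      (use proj_in_isoquant[OF c] in \<open>auto simp: isoquant_def\<close>)
  ultimately show ?thesis by (metis has_derivative_unique)
qed

lemma constant_if_derivative_zero:
  fixes F :: "real ^ 'n \<Rightarrow> real"
  assumes "\<And>x. x \<in> pos_orthant \<Longrightarrow> (F has_derivative (\<lambda>v. 0)) (at x)"
  shows "\<exists>a. \<forall>x\<in>pos_orthant. F x = a"
  by (rule has_derivative_zero_constant[OF convex_pos_orthant])
    (rule has_derivative_at_withinI, rule assms)

text \<open>Composed with \<open>proj c\<close>, the ratio of partials lives on the convex orthant.
  The numerator of its derivative vanishes because the Hessian sends the tangent vector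
  \<open>dproj c x v\<close> to a multiple of the gradient.\<close>

lemma grad_ratio_constant:
  assumes flat: "\<And>x i j. x \<in> pos_orthant \<Longrightarrow> i \<noteq> j \<Longrightarrow> pair_curv i j x + pair_curv j i x = 0" and c: "0 < c"
  shows "\<exists>a. \<forall>x\<in>isoquant f c. partial_deriv i f x = a * partial_deriv j f x"
proof -
  define F where "F x = partial_deriv i f (proj c x) / partial_deriv j f (proj c x)" for x
  have "(F has_derivative (\<lambda>v. 0)) (at x)" if x: "x \<in> pos_orthant" for x
  proof -
    define y where "y = proj c x"
    have y: "y \<in> pos_orthant"
      using proj_in_isoquant[OF c x] isoquant_subset by (auto simp: y_def)
    have dpart: "((\<lambda>x. partial_deriv i f (proj c x)) has_derivative
        (\<lambda>v. hess f y (dproj c x v) $ i)) (at x)" for i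
      using has_derivative_compose[OF has_derivative_proj[OF c x]
          has_derivative_grad[OF partial_differentiable[OF y[unfolded y_def]]]]
      by (simp add: hess_def y_def)
    have "partial_deriv j f (proj c x) \<noteq> 0"
      using partial_pos[OF y, of j] by (simp add: y_def)
    from has_derivative_divide'[OF dpart[of i] dpart[of j] this]
    have "(F has_derivative (\<lambda>v. (hess f y (dproj c x v) $ i * partial_deriv j f y -
        partial_deriv i f y * hess f y (dproj c x v) $ j) /
        (partial_deriv j f y * partial_deriv j f y))) (at x)"
      by (simp add: F_def [abs_def] y_def)
    moreover have "hess f y (dproj c x v) $ i * partial_deriv j f y -
        partial_deriv i f y * hess f y (dproj c x v) $ j = 0" for v
    proof -
      obtain l where "hess f y (dproj c x v) = l *\<^sub>R grad f y"
        using hess_tangent[OF flat[OF y] y] grad_dproj[OF c x] unfolding y_def by blast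
      then show ?thesis by (simp add: grad_nth)
    qed
    ultimately show ?thesis by simp
  qed
  from constant_if_derivative_zero[OF this]
  obtain a where a: "\<And>x. x \<in> pos_orthant \<Longrightarrow> F x = a" by blast
  have "partial_deriv i f x = a * partial_deriv j f x" if x: "x \<in> isoquant f c" for x
  proof -
    have "x \<in> pos_orthant" using x isoquant_subset by auto
    then show ?thesis
      using a[of x] partial_pos[of x j] proj_isoquant[OF c x] by (simp add: F_def field_simps)
  qed
  then show ?thesis by blast
qed

lemma isoquant_eq_hyperplane:
  assumes flat: "\<And>x i j. x \<in> pos_orthant \<Longrightarrow> i \<noteq> j \<Longrightarrow> pair_curv i j x + pair_curv j i x = 0" and c: "0 < c"
  obtains A :: "'n \<Rightarrow> real" where "\<And>i. 0 < A i"
    "isoquant f c = {x \<in> pos_orthant. (\<Sum>i\<in>UNIV. A i * x $ i) = 1}"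
proof -
  \<comment> \<open>An arbitrary reference index: on the isoquant the gradient is
    \<open>partial_deriv j f x\<close> times the constant vector \<open>a\<close>.\<close>
  fix j :: 'n
  have "\<exists>a. \<forall>x\<in>isoquant f c. partial_deriv i f x = a * partial_deriv j f x" for i
    by (rule grad_ratio_constant[OF flat c])
  then obtain a where a: "\<And>i x. x \<in> isoquant f c \<Longrightarrow> partial_deriv i f x = a i * partial_deriv j f x"
    by metis
  \<comment> \<open>The linear form with coefficients \<open>a\<close>, pulled back to the orthant;
    its derivative is proportional to
    \<open>grad f (proj c x) \<bullet> dproj c x v = 0\<close>.\<close>
  define G where "G x = (\<Sum>i\<in>UNIV. a i * proj c x $ i)" for x
  have "(G has_derivative (\<lambda>v. 0)) (at x)" if x: "x \<in> pos_orthant" for x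
  proof -
    have y: "proj c x \<in> isoquant f c" by (rule proj_in_isoquant[OF c x])
    then have pos: "partial_deriv j f (proj c x) > 0"
      using partial_pos isoquant_subset by auto
    have "(G has_derivative (\<lambda>v. \<Sum>i\<in>UNIV. a i * dproj c x v $ i)) (at x)"
      unfolding G_def
      by (rule has_derivative_sum, rule has_derivative_mult_right)
        (rule bounded_linear.has_derivative[OF bounded_linear_vec_nth has_derivative_proj[OF c x]])
    moreover have "(\<Sum>i\<in>UNIV. a i * dproj c x v $ i) = 0" for v
    proof -
      have "partial_deriv j f (proj c x) * (a i * w) = partial_deriv i f (proj c x) * w" for i w
        using a[OF y, of i] by (simp add: mult_ac)
      then have "partial_deriv j f (proj c x) * (\<Sum>i\<in>UNIV. a i * dproj c x v $ i) =
          grad f (proj c x) \<bullet> dproj c x v"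
        by (simp only: inner_vec_def grad_nth sum_distrib_left inner_real_def)
      then show ?thesis using grad_dproj[OF c x] pos by simp
    qed
    ultimately show ?thesis by simp
  qed
  from constant_if_derivative_zero[OF this]
  obtain b where b: "\<And>x. x \<in> pos_orthant \<Longrightarrow> G x = b" by blast
  obtain e where e: "e \<in> isoquant f c"
    using proj_in_isoquant[OF c one_in_pos_orthant] by blast
  then have e': "e \<in> pos_orthant" using isoquant_subset by auto
  have a_pos: "0 < a i" for i
  proof -
    have "0 < a i * partial_deriv j f e"
      using partial_pos[OF e', of i] a[OF e, of i] by metis
    then show ?thesis using partial_pos[OF e', of j] by (simp add: zero_less_mult_iff)
  qed
  have sum_b: "(\<Sum>i\<in>UNIV. a i * x $ i) = b" if "x \<in> isoquant f c" for x
    using b[of x] that isoquant_subset[of c] proj_isoquant[OF c that] by (auto simp: G_def)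
  have "0 < (\<Sum>i\<in>UNIV. a i * e $ i)"
    using a_pos e' by (intro sum_pos) (auto simp: pos_orthant_def)
  then have b_pos: "0 < b" using sum_b[OF e] by simp
  define A where "A i = a i / b" for i
  have A_pos: "0 < A i" for i using a_pos b_pos by (simp add: A_def)
  have A: "(\<Sum>i\<in>UNIV. A i * x $ i) = 1" if "x \<in> isoquant f c" for x
    using sum_b[OF that] b_pos by (simp add: A_def sum_divide_distrib[symmetric])
  have "x \<in> isoquant f c" if x: "x \<in> pos_orthant" and 1: "(\<Sum>i\<in>UNIV. A i * x $ i) = 1" for x
  proof -
    \<comment> \<open>This dilation takes \<open>x\<close> to the isoquant, hence back to the same
      hyperplane; monotonicity along the orbit will force \<open>t = 1\<close>.\<close>
    define t where "t = (c / f x) powr (1 / q)"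
    have t: "0 < t" using c f_pos[OF x] by (simp add: t_def)
    have y: "weighted_dilation g t x \<in> isoquant f c"
      using proj_in_isoquant[OF c x] by (simp add: proj_def t_def)
    \<comment> \<open>The reciprocal \<open>1 / t\<close> matches the negative exponents in
      \<open>powr_sum_inj\<close>.\<close>
    have "(\<Sum>i\<in>UNIV. A i * x $ i * (1 / t) powr (- g i)) =
        (\<Sum>i\<in>UNIV. A i * x $ i * 1 powr (- g i))"
    proof -
      have "(1 / t) powr (- g i) = t powr g i" for i
        using t by (simp add: powr_minus_divide powr_divide)
      then show ?thesis using A[OF y] 1 by (simp add: weighted_dilation_def mult_ac)
    qed
    then have "1 / t = 1"
      using t powr_sum_inj[OF g_pos A_pos x, of "1 / t" 1] by simp
    then show ?thesis using y t by (simp add: weighted_dilation_def)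
  qed
  then have "isoquant f c = {x \<in> pos_orthant. (\<Sum>i\<in>UNIV. A i * x $ i) = 1}"
    using A isoquant_subset by auto
  with A_pos show ?thesis by (rule that)
qed

section \<open>Transport between output levels\<close>

text \<open>The exponent \<open>- 1 / q\<close> is chosen so that the dilation multiplies
  \<open>f\<close> by \<open>c / d\<close>.\<close>

lemma isoquant_dilation:
  assumes "0 < c" "0 < d" "x \<in> pos_orthant"
  shows "x \<in> isoquant f d \<longleftrightarrow>
    weighted_dilation g ((d / c) powr (- 1 / q)) x \<in> isoquant f c"
proof -
  have "((d / c) powr (- 1 / q)) powr q = c / d"
    unfolding powr_powr using assms q_pos by (simp add: powr_minus)
  then have "f (weighted_dilation g ((d / c) powr (- 1 / q)) x) = (c / d) * f x"
    using assms by (simp add: f_dilation)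
  moreover have "(c / d) * f x = c \<longleftrightarrow> f x = d"
    using assms(1,2) by (simp add: field_simps)
  ultimately show ?thesis
    using assms by (simp add: isoquant_def weighted_dilation_in_pos_orthant)
qed

lemma isoquant_scaled:
  assumes A: "isoquant f c = {x \<in> pos_orthant. (\<Sum>i\<in>UNIV. A i * x $ i) = 1}"
    and "0 < c" "0 < d"
  shows "isoquant f d =
    {x \<in> pos_orthant. (\<Sum>i\<in>UNIV. A i * (d / c) powr (- g i / q) * x $ i) = 1}"
proof -
  have "x \<in> isoquant f d \<longleftrightarrow> (\<Sum>i\<in>UNIV. A i * (d / c) powr (- g i / q) * x $ i) = 1"
    if x: "x \<in> pos_orthant" for x
    unfolding isoquant_dilation[OF assms(2,3) x] A using x assms(2,3)
    by (simp add: weighted_dilation_in_pos_orthant)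
      (simp add: weighted_dilation_def powr_powr mult.assoc)
  then show ?thesis using isoquant_subset by auto
qed

end

lemma affine_isoquant_hyperplane_section:
  assumes "\<And>i. 0 < A i" "M = {x \<in> pos_orthant. (\<Sum>i\<in>UNIV. A i * x $ i) = 1}"
  shows "affine_isoquant M"
  unfolding affine_isoquant_def
proof (intro exI conjI)
  show "(\<chi> i. A i) \<noteq> 0"
    using assms(1) by (metis order_less_irrefl vec_lambda_beta zero_index)
  have "M = {x. (\<chi> i. A i) \<bullet> x = 1} \<inter> pos_orthant"
    by (auto simp: assms(2) inner_vec_def)
  then show "openin (top_of_set {x. (\<chi> i. A i) \<bullet> x = 1}) M"
    using open_pos_orthant by (auto simp: openin_open)
qed


theorem corollary3p14:
  fixes g :: "'n::finite \<Rightarrow> real" and q :: real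
    and f :: "real ^ 'n \<Rightarrow> real" and c :: "nat \<Rightarrow> real"
  assumes "CARD('n) \<ge> 3"
    and "\<And>i. 0 < g i"
    and "pair_sum_nonresonant g"
    and "0 < q"
    and "weighted_homogeneous_production g q f"
    and "inj_on c {1..CARD('n) choose 2}"
    and "\<And>r. r \<in> {1..CARD('n) choose 2} \<Longrightarrow> 0 < c r"
    and "\<And>r. r \<in> {1..CARD('n) choose 2} \<Longrightarrow> euclidean_minimal (isoquant f (c r))"
  shows "(\<forall>d>0. affine_isoquant (isoquant f d)) \<and>
    (\<forall>c0>0. \<exists>A :: 'n \<Rightarrow> real. (\<forall>i. 0 < A i) \<and>
       (\<forall>d>0. isoquant f d =
          {x \<in> pos_orthant. (\<Sum>i\<in>UNIV. A i * (d / c0) powr (- g i / q) * x $ i) = 1}) \<and>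
       (\<exists>\<rho> :: real ^ 'n \<Rightarrow> real. \<forall>x\<in>pos_orthant.
          0 < \<rho> x \<and> (\<Sum>i\<in>UNIV. A i * x $ i * \<rho> x powr (- g i)) = 1 \<and>
          (\<forall>s>0. (\<Sum>i\<in>UNIV. A i * x $ i * s powr (- g i)) = 1 \<longrightarrow> s = \<rho> x) \<and>
          f x = c0 * \<rho> x powr q))"
proof -
  interpret production g q f
    using assms by unfold_locales auto
  have flat: "pair_curv i j x + pair_curv j i x = 0" if "x \<in> pos_orthant" "i \<noteq> j" for i j x
  proof (rule pair_curv_zero)
    show "CARD('n) choose 2 \<le> card (c ` {1..CARD('n) choose 2})"
      using assms(6) by (simp add: card_image)
  qed (use assms that in auto)
  have affine: "affine_isoquant (isoquant f d)" if d: "0 < d" for d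
  proof -
    obtain A :: "'n \<Rightarrow> real" where "\<And>i. 0 < A i"
      "isoquant f d = {x \<in> pos_orthant. (\<Sum>i\<in>UNIV. A i * x $ i) = 1}"
      using isoquant_eq_hyperplane[OF flat d] by blast
    then show ?thesis by (rule affine_isoquant_hyperplane_section)
  qed
  have "\<exists>A :: 'n \<Rightarrow> real. (\<forall>i. 0 < A i) \<and>
       (\<forall>d>0. isoquant f d =
          {x \<in> pos_orthant. (\<Sum>i\<in>UNIV. A i * (d / c0) powr (- g i / q) * x $ i) = 1}) \<and>
       (\<exists>\<rho> :: real ^ 'n \<Rightarrow> real. \<forall>x\<in>pos_orthant.
          0 < \<rho> x \<and> (\<Sum>i\<in>UNIV. A i * x $ i * \<rho> x powr (- g i)) = 1 \<and>
          (\<forall>s>0. (\<Sum>i\<in>UNIV. A i * x $ i * s powr (- g i)) = 1 \<longrightarrow> s = \<rho> x) \<and>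
          f x = c0 * \<rho> x powr q)" if c0: "0 < c0" for c0
  proof -
    obtain A :: "'n \<Rightarrow> real" where A_pos: "\<And>i. 0 < A i"
      and A: "isoquant f c0 = {x \<in> pos_orthant. (\<Sum>i\<in>UNIV. A i * x $ i) = 1}"
      using isoquant_eq_hyperplane[OF flat c0] by blast
    define \<rho> where "\<rho> x = (f x / c0) powr (1 / q)" for x
    have "0 < \<rho> x \<and> (\<Sum>i\<in>UNIV. A i * x $ i * \<rho> x powr (- g i)) = 1 \<and>
          (\<forall>s>0. (\<Sum>i\<in>UNIV. A i * x $ i * s powr (- g i)) = 1 \<longrightarrow> s = \<rho> x) \<and>
          f x = c0 * \<rho> x powr q" if x: "x \<in> pos_orthant" for x
    proof (intro conjI allI impI)
      note fx = f_pos[OF x]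
      show \<rho>_pos: "0 < \<rho> x" using fx c0 by (simp add: \<rho>_def)
      \<comment> \<open>The hyperplane equation at the level \<open>f x\<close> of \<open>x\<close>
        itself is the equation for \<open>\<rho> x\<close>, because
        \<open>(f x / c0) powr (- g i / q)\<close> equals
        \<open>\<rho> x powr (- g i)\<close>.\<close>
      have "x \<in> isoquant f (f x)" using x by (simp add: isoquant_def)
      then show \<rho>_sum: "(\<Sum>i\<in>UNIV. A i * x $ i * \<rho> x powr (- g i)) = 1"
        by (subst (asm) isoquant_scaled[OF A c0 fx]) (simp add: \<rho>_def powr_powr mult_ac)
      show "s = \<rho> x" if "0 < s" "(\<Sum>i\<in>UNIV. A i * x $ i * s powr (- g i)) = 1" for s
        by (rule powr_sum_inj[of g A x]) (use g_pos A_pos x that \<rho>_pos \<rho>_sum in auto)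
      show "f x = c0 * \<rho> x powr q"
        using fx c0 q_pos by (simp add: \<rho>_def powr_powr)
    qed
    then show ?thesis
      using A_pos isoquant_scaled[OF A c0] by blast
  qed
  with affine show ?thesis by blast
qed

end
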